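(* Let $r \ge 2$ be a fixed integer. For any two positive integers $k$ and $t$ there exists a constant $c_{r,k,t}$, depending only on $r,k,t$, such that for every positive integer $n$, $$\mathrm{ex}_r(n, \Theta_{k,t}^{B}) \le c_{r,k,t}\, n^{1+\frac{1}{k}}.$$
   Context: All graphs and hypergraphs are finite and simple (no repeated edges). An $r$-uniform hypergraph is one in which every hyperedge has exactly $r$ vertices. The theta graph $\Theta_{k,t}$ is the simple ($2$-uniform) graph formed by $t$ internally vertex-disjoint paths of length $k$ (i.e. with $k$ edges) between a fixed pair of distinct vertices. For a graph $F$, a hypergraph $H$ is called a Berge-$F$ if $V(F)\subseteq V(H)$ (after identifying $F$ with an isomorphic copy) and there is a bijection $\phi:E(F)\to E(H)$ such that $e\subseteq \phi(e)$ for all $e\in E(F)$. For fixed uniformity $r$, $F^{B}=F^{B,r}$ denotes the family of all $r$-uniform hypergraphs that are a Berge-$F$; in particular $\Theta_{k,t}^{B}$ is the family of all $r$-uniform Berge-$\Theta_{k,t}$ hypergraphs. For a family $\mathcal{F}$ of $r$-uniform hypergraphs, $\mathrm{ex}_r(n,\mathcal{F})$ denotes the maximum number of hyperedges in an $n$-vertex $r$-uniform hypergraph that contains no member of $\mathcal{F}$ as a subhypergraph. *)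

theory Defs
  imports "HOL-Analysis.Analysis"
begin

record 'a hypergraph =
  verts :: "'a set"
  edges :: "'a set set"

definition uniform_hypergraph :: "nat \<Rightarrow> 'a hypergraph \<Rightarrow> bool" where
  "uniform_hypergraph r H \<longleftrightarrow>
     finite (verts H) \<and> (\<forall>e\<in>edges H. e \<subseteq> verts H \<and> card e = r)"

text \<open>
  The vertex at position \<open>j\<close> of the \<open>i\<close>-th path. The first and the last vertices of all paths
  are identified; the inner vertices of different paths are distinct.
\<close>

definition theta_vertex :: "nat \<Rightarrow> nat \<Rightarrow> nat \<Rightarrow> nat \<times> nat" where
  "theta_vertex k i j = (if j = 0 \<or> j = k then (0, j) else (i, j))"

text \<open>
  The edges form a set, so the graph is simple. In particular, for \<open>k = 1\<close> the \<open>t\<close> paths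
  coincide and the graph is a single edge.
\<close>

definition theta_graph :: "nat \<Rightarrow> nat \<Rightarrow> (nat \<times> nat) hypergraph" where
  "theta_graph k t =
     \<lparr>verts = {theta_vertex k i j | i j. i < t \<and> j \<le> k},
      edges = {{theta_vertex k i j, theta_vertex k i (Suc j)} | i j. i < t \<and> j < k}\<rparr>"

text \<open>
  The injection \<open>f\<close> identifies \<open>F\<close> with an isomorphic copy of it whose vertices lie in \<open>H\<close>.
\<close>

definition is_berge :: "'a hypergraph \<Rightarrow> 'b hypergraph \<Rightarrow> bool" where
  "is_berge F H \<longleftrightarrow>
     (\<exists>f \<phi>. inj_on f (verts F) \<and> f ` verts F \<subseteq> verts H \<and>
        bij_betw \<phi> (edges F) (edges H) \<and> (\<forall>e\<in>edges F. f ` e \<subseteq> \<phi> e))"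

text \<open>
  All hypergraphs are finite, so vertices in \<open>nat\<close> represent every isomorphism type.
\<close>

definition berge_family :: "nat \<Rightarrow> 'a hypergraph \<Rightarrow> nat hypergraph set" where
  "berge_family r F = {H. uniform_hypergraph r H \<and> is_berge F H}"

text \<open>\<open>H\<close> has a subhypergraph isomorphic to \<open>G\<close>.\<close>

definition contains_copy :: "'b hypergraph \<Rightarrow> 'a hypergraph \<Rightarrow> bool" where
  "contains_copy H G \<longleftrightarrow>
     (\<exists>g. inj_on g (verts G) \<and> g ` verts G \<subseteq> verts H \<and> (\<lambda>e. g ` e) ` edges G \<subseteq> edges H)"

definition free_hypergraphs :: "nat \<Rightarrow> nat \<Rightarrow> 'a hypergraph set \<Rightarrow> nat hypergraph set" where
  "free_hypergraphs r n \<F> =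
     {H. uniform_hypergraph r H \<and> card (verts H) = n \<and> (\<forall>G\<in>\<F>. \<not> contains_copy H G)}"

text \<open>
  The set under \<open>Max\<close> is always finite (lemma \<open>finite_card_edges_free\<close>). It is empty only if
  \<open>\<F>\<close> has an edgeless member with at most \<open>n\<close> vertices; this does not happen for the
  Berge copies of theta graphs (lemma \<open>free_hypergraphs_theta_nonempty\<close>).
\<close>

definition ex_number :: "nat \<Rightarrow> nat \<Rightarrow> 'a hypergraph set \<Rightarrow> nat" where
  "ex_number r n \<F> = Max ((\<lambda>H. card (edges H)) ` free_hypergraphs r n \<F>)"

lemma finite_card_edges_free:
  "finite ((\<lambda>H. card (edges H)) ` free_hypergraphs r n \<F>)"
proof -
  have "card (edges H) \<le> 2 ^ n" if "H \<in> free_hypergraphs r n \<F>" for H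
  proof -
    have fin: "finite (verts H)" and sub: "edges H \<subseteq> Pow (verts H)" and n: "card (verts H) = n"
      using that by (auto simp: free_hypergraphs_def uniform_hypergraph_def)
    have "card (edges H) \<le> card (Pow (verts H))"
      using fin sub by (intro card_mono) auto
    then show ?thesis
      using fin n by (simp add: card_Pow)
  qed
  then have "(\<lambda>H. card (edges H)) ` free_hypergraphs r n \<F> \<subseteq> {..2 ^ n}"
    by auto
  then show ?thesis
    using finite_subset by blast
qed

lemma free_hypergraphs_theta_nonempty:
  assumes "k \<ge> 1" and "t \<ge> 1"
  shows "free_hypergraphs r n (berge_family r (theta_graph k t)) \<noteq> {}"
proof -
  have ne: "edges (theta_graph k t) \<noteq> {}"
  proof -
    have "0 < t" and "0 < k"
      using assms by auto
    then have "{theta_vertex k 0 0, theta_vertex k 0 (Suc 0)} \<in> edges (theta_graph k t)"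
      unfolding theta_graph_def by fastforce
    then show ?thesis
      by blast
  qed
  have "\<lparr>verts = {..<n}, edges = {}\<rparr> \<in> free_hypergraphs r n (berge_family r (theta_graph k t))"
    using ne by (auto simp: free_hypergraphs_def uniform_hypergraph_def berge_family_def
        is_berge_def contains_copy_def bij_betw_def)
  then show ?thesis
    by blast
qed

lemma uniform_theta_graph: "uniform_hypergraph 2 (theta_graph k t)"
proof -
  have "verts (theta_graph k t) = (\<lambda>(i, j). theta_vertex k i j) ` ({..<t} \<times> {..k})"
    by (auto simp: theta_graph_def)
  then have "finite (verts (theta_graph k t))"
    by simp
  moreover have "theta_vertex k i j \<noteq> theta_vertex k i (Suc j)" for i j
    by (auto simp: theta_vertex_def)
  ultimately show ?thesis
    unfolding uniform_hypergraph_def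
    by (fastforce simp: theta_graph_def)
qed

lemma card_edges_theta_graph:
  assumes "k \<ge> 2"
  shows "card (edges (theta_graph k t)) = t * k"
proof -
  let ?e = "\<lambda>(i, j). {theta_vertex k i j, theta_vertex k i (Suc j)}"
  have "edges (theta_graph k t) = ?e ` ({..<t} \<times> {..<k})"
    by (auto simp: theta_graph_def)
  moreover have "inj_on ?e ({..<t} \<times> {..<k})"
    using assms
    by (auto simp: inj_on_def theta_vertex_def doubleton_eq_iff split: if_splits)
  ultimately show ?thesis
    by (simp add: card_image)
qed

end

theory Submission
  imports Defs
begin

text \<open>
  Repeatedly pick a pair of vertices that is covered by at least one but only boundedly many of the
  remaining hyperedges, label it with one of them, and delete all hyperedges covering it. A
  hypergraph in which no such pair exists contains a Berge theta graph, so the process exhausts all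
  hyperedges; the picked pairs form a graph that is theta-free (its edges have distinct labels) and
  has at least a constant fraction as many edges as there are hyperedges.

  This leaves the graph case, due to Faudree and Simonovits. In a graph of minimum degree \<open>d\<close>, take
  breadth-first search layers \<open>V\<^sub>0, \<dots>, V\<^sub>k\<close>. If two consecutive layers \<open>V\<^sub>l, V\<^sub>l\<^sub>+\<^sub>1\<close> spanned many
  edges, then one could find a tree vertex \<open>z\<close> at some height \<open>h\<close> above \<open>V\<^sub>l\<close> and a dense piece of
  these edges below \<open>z\<close> such that the neighbours of every vertex are spread over many child subtrees
  of \<open>z\<close>. A spider with \<open>t\<close> legs of length \<open>k - h\<close>, whose leaves lie in distinct subtrees, is then
  completed by tree paths to \<open>z\<close>. Hence each layer is larger than the previous one by a factor of
  order \<open>d\<close>, and \<open>d ^ k = O(n)\<close>.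
\<close>

section \<open>Embedding theta graphs greedily\<close>

text \<open>Graphs are encoded as relations, symmetric wherever edges are counted, so that
  neighbourhoods are relational images and distances come from relational powers. An edge with
  distinct ends contributes both its orientations to \<open>card E\<close>.\<close>

definition has_theta :: "('a \<times> 'a) set \<Rightarrow> nat \<Rightarrow> nat \<Rightarrow> bool" where
  "has_theta E k t \<longleftrightarrow>
     (\<exists>f. inj_on f (verts (theta_graph k t)) \<and>
        (\<forall>i<t. \<forall>j<k. (f (theta_vertex k i j), f (theta_vertex k i (Suc j))) \<in> E))"

lemma has_theta_mono:
  assumes "has_theta E k t" and "E \<subseteq> E'"
  shows "has_theta E' k t"
  using assms unfolding has_theta_def by blast

text \<open>The hypotheses make \<open>p i j\<close> and \<open>theta_vertex k i j\<close> identify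
  the same positions, so \<open>p\<close> factors through an injection on the vertices of the theta
  graph.\<close>

lemma has_thetaI:
  fixes p :: "nat \<Rightarrow> nat \<Rightarrow> 'a"
  assumes start: "\<And>i. i < t \<Longrightarrow> p i 0 = u" and stop: "\<And>i. i < t \<Longrightarrow> p i k = z"
    and "u \<noteq> z"
    and path: "\<And>i j. i < t \<Longrightarrow> j < k \<Longrightarrow> (p i j, p i (Suc j)) \<in> E"
    and inj: "\<And>i j i' j'. \<lbrakk>i < t; i' < t; 0 < j; j < k; 0 < j'; j' < k; p i j = p i' j'\<rbrakk>
      \<Longrightarrow> i = i' \<and> j = j'"
    and inner: "\<And>i j. i < t \<Longrightarrow> 0 < j \<Longrightarrow> j < k \<Longrightarrow> p i j \<noteq> u \<and> p i j \<noteq> z"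
  shows "has_theta E k t"
proof -
  define f where "f = (\<lambda>(i, j). if j = 0 then u else if j = k then z else p i j)"
  have f: "f (theta_vertex k i j) = p i j" if "i < t" "j \<le> k" for i j
    using that start stop by (auto simp: f_def theta_vertex_def)
  have *: "theta_vertex k i j = theta_vertex k i' j'"
    if *: "i < t" "j \<le> k" "i' < t" "j' \<le> k" "p i j = p i' j'" for i j i' j'
  proof -
    consider "j = 0" | "j = k" | "0 < j" "j < k" using * by linarith
    then show ?thesis
    proof cases
      case 1
      then have "\<not> (0 < j' \<and> j' < k)" "j' \<noteq> k"
        using * inner[of i' j'] start stop \<open>u \<noteq> z\<close> by metis+
      then have "j' = 0" using * by linarith
      then show ?thesis using 1 by (simp add: theta_vertex_def)
    next
      case 2
      then have "\<not> (0 < j' \<and> j' < k)" "j' \<noteq> 0"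
        using * inner[of i' j'] start stop \<open>u \<noteq> z\<close> by metis+
      then have "j' = k" using * by linarith
      then show ?thesis using 2 by (simp add: theta_vertex_def)
    next
      case 3
      then have "j' \<noteq> 0" "j' \<noteq> k"
        using * inner[of i j] start stop by metis+
      then show ?thesis using inj[of i i' j j'] 3 * by auto
    qed
  qed
  have "x = y" if "x \<in> verts (theta_graph k t)" "y \<in> verts (theta_graph k t)" "f x = f y" for x y
  proof -
    obtain i j i' j' where "x = theta_vertex k i j" "y = theta_vertex k i' j'"
      "i < t" "j \<le> k" "i' < t" "j' \<le> k"
      using \<open>x \<in> _\<close> \<open>y \<in> _\<close> unfolding theta_graph_def by auto
    then show ?thesis using * f \<open>f x = f y\<close> by metis
  qed
  then have "inj_on f (verts (theta_graph k t))"
    by (rule inj_onI)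
  then show ?thesis
    using path unfolding has_theta_def by (intro exI[of _ f]) (auto simp: f)
qed

lemma has_theta_one:
  assumes "(u, v) \<in> E" and "u \<noteq> v"
  shows "has_theta E 1 t"
  by (rule has_thetaI[where p = "\<lambda>i j. if j = 0 then u else v" and u = u and z = v])
    (use assms in auto)

text \<open>The forbidden set and the new vertices together stay within \<open>K\<close>, so every
  step can avoid both. The target sets vary with the position so that the last vertex can obey an
  extra condition. Injectivity leaves out the start; putting it into \<open>X\<close> keeps the path
  from returning there.\<close>

lemma greedy_path:
  fixes T :: "nat \<Rightarrow> 'a set"
  assumes "u \<in> T 0"
    and "\<And>j x X. \<lbrakk>j < m; x \<in> T j; finite X; card X \<le> K\<rbrakk> \<Longrightarrow> \<exists>y\<in>T (Suc j). (x, y) \<in> E \<and> y \<notin> X"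
    and "finite X" and "card X + m \<le> K"
  shows "\<exists>q. q 0 = u \<and> (\<forall>j\<le>m. q j \<in> T j) \<and> (\<forall>j<m. (q j, q (Suc j)) \<in> E) \<and>
           inj_on q {1..m} \<and> q ` {1..m} \<inter> X = {}"
  using assms
proof (induction m)
  case 0
  then show ?case by (intro exI[of _ "\<lambda>_. u"]) auto
next
  case (Suc m)
  have "\<exists>q. q 0 = u \<and> (\<forall>j\<le>m. q j \<in> T j) \<and> (\<forall>j<m. (q j, q (Suc j)) \<in> E) \<and>
           inj_on q {1..m} \<and> q ` {1..m} \<inter> X = {}"
    using Suc.prems by (intro Suc.IH) auto
  then obtain q where q: "q 0 = u" "\<forall>j\<le>m. q j \<in> T j" "\<forall>j<m. (q j, q (Suc j)) \<in> E"
      "inj_on q {1..m}" "q ` {1..m} \<inter> X = {}"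
    by blast
  have "card (X \<union> q ` {1..m}) \<le> card X + card (q ` {1..m})"
    by (rule card_Un_le)
  also have "\<dots> \<le> card X + m" using card_image_le[of "{1..m}" q] by simp
  finally have "card (X \<union> q ` {1..m}) \<le> K" using Suc.prems by simp
  then obtain y where y: "y \<in> T (Suc m)" "(q m, y) \<in> E" "y \<notin> X" "y \<notin> q ` {1..m}"
    using Suc.prems(2)[of m "q m" "X \<union> q ` {1..m}"] Suc.prems(3) q(2) by auto
  have img: "(q(Suc m := y)) ` {1..m} = q ` {1..m}"
    by auto
  have ins: "{1..Suc m} = insert (Suc m) {1..m}" and "{1..m} - {Suc m} = {1..m}" by auto
  then have "inj_on (q(Suc m := y)) {1..Suc m}"
    using inj_on_fun_updI[OF q(4) y(4)] y(4) img by (simp only: inj_on_insert fun_upd_same simp_thms)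
  moreover have "(q(Suc m := y)) ` {1..Suc m} \<inter> X = {}"
    using q(5) y(3) img by (simp only: ins image_insert fun_upd_same) blast
  moreover have "\<forall>j\<le>Suc m. (q(Suc m := y)) j \<in> T j" "(q(Suc m := y)) 0 = u"
    "\<forall>j<Suc m. ((q(Suc m := y)) j, (q(Suc m := y)) (Suc j)) \<in> E"
    using q(1-3) y(1,2) by (auto simp: le_Suc_eq less_Suc_eq)
  ultimately show ?case by blast
qed

text \<open>Legs are grown one at a time, each avoiding the centre and all earlier legs; at most
  \<open>t * m + 1\<close> vertices are ever forbidden. Only steps out of \<open>B\<close> can
  control \<open>col\<close>, so the parity is chosen such that each leg ends with a step from
  \<open>B\<close> into \<open>A\<close>, where the colours of earlier ends are avoided.\<close>

lemma greedy_spider: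
  fixes A B :: "'a set" and col :: "'a \<Rightarrow> 'b"
  assumes stepA: "\<And>a X. \<lbrakk>a \<in> A; finite X; card X \<le> K\<rbrakk> \<Longrightarrow> \<exists>b\<in>B. (a, b) \<in> E \<and> b \<notin> X"
    and stepB: "\<And>b X Y. \<lbrakk>b \<in> B; finite X; card X \<le> K; finite Y; card Y \<le> K\<rbrakk>
      \<Longrightarrow> \<exists>a\<in>A. (b, a) \<in> E \<and> a \<notin> X \<and> col a \<notin> Y"
    and "B \<noteq> {}" and "m \<ge> 1" and "t * m + 1 \<le> K"
  obtains u q where
    "u \<in> A \<union> B" "\<And>i. i < t \<Longrightarrow> q i 0 = u"
    "\<And>i j. i < t \<Longrightarrow> j \<le> m \<Longrightarrow> q i j \<in> A \<union> B" "\<And>i. i < t \<Longrightarrow> q i m \<in> A"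
    "\<And>i j. i < t \<Longrightarrow> j < m \<Longrightarrow> (q i j, q i (Suc j)) \<in> E"
    "inj_on (\<lambda>(i, j). q i j) ({..<t} \<times> {1..m})"
    "\<And>i j. i < t \<Longrightarrow> 1 \<le> j \<Longrightarrow> j \<le> m \<Longrightarrow> q i j \<noteq> u"
    "inj_on (\<lambda>i. col (q i m)) {..<t}"
proof -
  \<comment> \<open>The side on which position \<open>j\<close> of a leg must lie, so that every leg ends in \<open>A\<close>.\<close>
  define side where "side j = (if even (m - j) then A else B)" for j
  obtain b where b: "b \<in> B" using \<open>B \<noteq> {}\<close> by blast
  have "A \<noteq> {}" using stepB[OF b, of "{}" "{}"] by auto
  then have "side 0 \<noteq> {}"
    using b by (auto simp: side_def)
  then obtain u where u: "u \<in> side 0" by blast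
  have "\<exists>q. (\<forall>i<s. q i 0 = u \<and> (\<forall>j\<le>m. q i j \<in> side j) \<and> (\<forall>j<m. (q i j, q i (Suc j)) \<in> E)
          \<and> (\<forall>j\<in>{1..m}. q i j \<noteq> u)) \<and>
        inj_on (\<lambda>(i, j). q i j) ({..<s} \<times> {1..m}) \<and> inj_on (\<lambda>i. col (q i m)) {..<s}"
    if "s \<le> t" for s
    using that
  proof (induction s)
    case 0
    then show ?case by simp
  next
    case (Suc s)
    then obtain q where q: "\<forall>i<s. q i 0 = u \<and> (\<forall>j\<le>m. q i j \<in> side j) \<and>
          (\<forall>j<m. (q i j, q i (Suc j)) \<in> E) \<and> (\<forall>j\<in>{1..m}. q i j \<noteq> u)"
        "inj_on (\<lambda>(i, j). q i j) ({..<s} \<times> {1..m})" "inj_on (\<lambda>i. col (q i m)) {..<s}"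
      by auto
    define X where "X = insert u ((\<lambda>(i, j). q i j) ` ({..<s} \<times> {1..m}))"
    define Y where "Y = (\<lambda>i. col (q i m)) ` {..<s}"
    define T where "T j = (if j = m then {a \<in> A. col a \<notin> Y} else side j)" for j
    have "card X \<le> 1 + card ((\<lambda>(i, j). q i j) ` ({..<s} \<times> {1..m}))"
      unfolding X_def using card_insert_le_m1 by (simp add: card_insert_if)
    also have "\<dots> \<le> 1 + s * m"
      using card_image_le[of "{..<s} \<times> {1..m}" "\<lambda>(i, j). q i j"] by simp
    finally have cX: "card X \<le> 1 + s * m" .
    have "Suc s * m \<le> t * m" using Suc.prems mult_le_mono1 by blast
    then have cX': "card X + m \<le> K" using cX \<open>t * m + 1 \<le> K\<close> by simp
    have "t \<le> t * m" using \<open>m \<ge> 1\<close> by simp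
    moreover have "card Y \<le> s" unfolding Y_def using card_image_le[of "{..<s}"] by fastforce
    ultimately have cY: "card Y \<le> K" using Suc.prems \<open>t * m + 1 \<le> K\<close> by linarith
    have fin: "finite X" "finite Y" by (auto simp: X_def Y_def)
    have step: "\<exists>y\<in>T (Suc j). (x, y) \<in> E \<and> y \<notin> Z"
      if "j < m" "x \<in> T j" "finite Z" "card Z \<le> K" for j x Z
    proof (cases "even (m - j)")
      case True
      then have "x \<in> A" "odd (m - Suc j)" "Suc j \<noteq> m"
        using that by (auto simp: T_def side_def split: if_splits)
      then show ?thesis using stepA[of x Z] that by (auto simp: T_def side_def)
    next
      case False
      then have "x \<in> B" "even (m - Suc j)"
        using that by (auto simp: T_def side_def split: if_splits)
      then show ?thesis using stepB[of x Z Y] that fin cY by (auto simp: T_def side_def)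
    qed
    have "u \<in> T 0" using u \<open>m \<ge> 1\<close> by (simp add: T_def)
    then obtain p where p: "p 0 = u" "\<forall>j\<le>m. p j \<in> T j" "\<forall>j<m. (p j, p (Suc j)) \<in> E"
        "inj_on p {1..m}" "p ` {1..m} \<inter> X = {}"
      using greedy_path[of u T m K E X] step fin cX' by blast
    have pside: "p j \<in> side j" if "j \<le> m" for j
      using p(2) that by (auto simp: T_def side_def split: if_splits)
    have pu: "p j \<noteq> u" if "j \<in> {1..m}" for j
      using p(5) that by (auto simp: X_def)
    have pq: "p j \<noteq> q i j'" if "j \<in> {1..m}" "i < s" "j' \<in> {1..m}" for i j j'
      using p(5) that unfolding X_def by fastforce
    have pcol: "col (p m) \<noteq> col (q i m)" if "i < s" for i
      using p(2) that by (auto simp: T_def Y_def)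
    let ?q = "q(s := p)"
    have "inj_on (\<lambda>(i, j). ?q i j) ({..<Suc s} \<times> {1..m})"
    proof (rule inj_onI)
      fix x y
      assume xy: "x \<in> {..<Suc s} \<times> {1..m}" "y \<in> {..<Suc s} \<times> {1..m}"
        "(\<lambda>(i, j). ?q i j) x = (\<lambda>(i, j). ?q i j) y"
      obtain i j i' j' where xy': "x = (i, j)" "y = (i', j')"
        by (cases x, cases y)
      have *: "i < Suc s" "1 \<le> j" "j \<le> m" "i' < Suc s" "1 \<le> j'" "j' \<le> m" "?q i j = ?q i' j'"
        using xy by (simp_all add: xy')
      consider "i = s" "i' = s" | "i = s" "i' < s" | "i < s" "i' = s" | "i < s" "i' < s"
        using * by linarith
      then have "i = i' \<and> j = j'"
      proof cases
        case 1
        then show ?thesis using * inj_onD[OF p(4), of j j'] by simp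
      next
        case 2
        then show ?thesis using * pq[of j i' j'] by simp
      next
        case 3
        then show ?thesis using * pq[of j' i j] by simp
      next
        case 4
        then show ?thesis using * inj_onD[OF q(2), of "(i, j)" "(i', j')"] by simp
      qed
      then show "x = y" by (simp add: xy')
    qed
    moreover have "inj_on (\<lambda>i. col (?q i m)) {..<Suc s}"
    proof (rule inj_onI)
      fix i i' assume "i \<in> {..<Suc s}" "i' \<in> {..<Suc s}" "col (?q i m) = col (?q i' m)"
      then show "i = i'"
        using inj_onD[OF q(3), of i i'] pcol[of i] pcol[of i']
        by (cases "i = s"; cases "i' = s") auto
    qed
    moreover have "?q i 0 = u \<and> (\<forall>j\<le>m. ?q i j \<in> side j) \<and>
        (\<forall>j<m. (?q i j, ?q i (Suc j)) \<in> E) \<and> (\<forall>j\<in>{1..m}. ?q i j \<noteq> u)"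
      if "i < Suc s" for i
    proof (cases "i = s")
      case True
      then show ?thesis using p(1,3) pside pu by simp
    next
      case False
      then have "i < s" using that by simp
      then show ?thesis using q(1) False by simp
    qed
    ultimately show ?case
      by (intro exI[of _ ?q] conjI allI impI) blast+
  qed
  from this[OF order_refl] obtain q where q: "\<forall>i<t. q i 0 = u \<and> (\<forall>j\<le>m. q i j \<in> side j) \<and>
        (\<forall>j<m. (q i j, q i (Suc j)) \<in> E) \<and> (\<forall>j\<in>{1..m}. q i j \<noteq> u)"
      "inj_on (\<lambda>(i, j). q i j) ({..<t} \<times> {1..m})" "inj_on (\<lambda>i. col (q i m)) {..<t}"
    by blast
  have side: "side j \<subseteq> A \<union> B" for j by (auto simp: side_def)
  have "side m = A" by (simp add: side_def)
  show ?thesis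
  proof (rule that[of u q])
    show "u \<in> A \<union> B" using u side by blast
    show "q i j \<in> A \<union> B" if "i < t" "j \<le> m" for i j using that q(1) side by blast
    show "q i m \<in> A" if "i < t" for i using that q(1) \<open>side m = A\<close> by blast
    show "q i j \<noteq> u" if "i < t" "1 \<le> j" "j \<le> m" for i j using that q(1) by auto
  qed (use q in auto)
qed

text \<open>The legs of a spider are prolonged by \<open>h\<close> steps of \<open>up\<close> to the
  common apex \<open>z\<close>. Colouring the ends by their ancestor just below \<open>z\<close>
  keeps the prolongations disjoint: by \<open>lev\<close> two of them can meet only at equal
  heights, and once merged they would share that ancestor. By \<open>out\<close> they avoid the
  legs.\<close>

lemma spider_theta:
  fixes A B :: "'a set" and up :: "'a \<Rightarrow> 'a"
  assumes stepA: "\<And>a X. \<lbrakk>a \<in> A; finite X; card X \<le> K\<rbrakk> \<Longrightarrow> \<exists>b\<in>B. (a, b) \<in> E \<and> b \<notin> X"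
    and stepB: "\<And>b X Y. \<lbrakk>b \<in> B; finite X; card X \<le> K; finite Y; card Y \<le> K\<rbrakk>
      \<Longrightarrow> \<exists>a\<in>A. (b, a) \<in> E \<and> a \<notin> X \<and> (up ^^ (h - 1)) a \<notin> Y"
    and "B \<noteq> {}" and m: "m \<ge> 1" and K: "t * m + 1 \<le> K" and h: "h \<ge> 1" and t: "t \<ge> 1"
    and up: "\<And>a j. a \<in> A \<Longrightarrow> j < h \<Longrightarrow> ((up ^^ j) a, (up ^^ Suc j) a) \<in> E"
    and out: "\<And>a j. a \<in> A \<Longrightarrow> 1 \<le> j \<Longrightarrow> j \<le> h \<Longrightarrow> (up ^^ j) a \<notin> A \<union> B"
    and top: "\<And>a. a \<in> A \<Longrightarrow> (up ^^ h) a = z"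
    and lev: "\<And>a a' j j'. \<lbrakk>a \<in> A; a' \<in> A; j \<le> h; j' \<le> h; (up ^^ j) a = (up ^^ j') a'\<rbrakk> \<Longrightarrow> j = j'"
  shows "has_theta E (m + h) t"
proof (rule greedy_spider[where A = A and B = B and E = E and K = K and m = m and t = t
      and col = "up ^^ (h - 1)"], goal_cases)
  case 1
  then show ?case by (rule stepA)
next
  case 2
  then show ?case by (rule stepB)
next
  case (6 u q)
  note q = this
  define p where "p i j = (if j \<le> m then q i j else (up ^^ (j - m)) (q i m))" for i j
  have p1: "p i j = q i j" if "j \<le> m" for i j using that by (simp add: p_def)
  have p2: "p i j = (up ^^ (j - m)) (q i m)" if "m \<le> j" for i j using that by (simp add: p_def)
  have z: "z \<notin> A \<union> B" using q(4)[of 0] top[of "q 0 m"] out[of "q 0 m" h] h t by auto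
  have p2': "p i j \<notin> A \<union> B" if "i < t" "m < j" "j \<le> m + h" for i j
    using p2[of j i] out[of "q i m" "j - m"] q(4)[of i] that by auto
  have p1': "p i j \<in> A \<union> B" if "i < t" "j \<le> m" for i j
    using p1[of j i] q(3)[of i j] that by auto
  show ?thesis
  proof (rule has_thetaI[where p = p and u = u and z = z])
    show "p i 0 = u" if "i < t" for i using that q(2) p1 by simp
    show "p i (m + h) = z" if "i < t" for i using that q(4) top p2 by simp
    show "u \<noteq> z" using q(1) z by blast
    show "(p i j, p i (Suc j)) \<in> E" if "i < t" "j < m + h" for i j
    proof (cases "j < m")
      case True
      then show ?thesis using q(5)[of i j] that by (simp add: p1)
    next
      case False
      then show ?thesis using up[of "q i m" "j - m"] q(4)[of i] that
        by (simp add: p2 Suc_diff_le)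
    qed
    show "p i j \<noteq> u \<and> p i j \<noteq> z" if *: "i < t" "0 < j" "j < m + h" for i j
    proof (cases "j \<le> m")
      case True
      then show ?thesis using q(7)[of i j] p1'[of i j] z * by (auto simp: p1)
    next
      case False
      then have "p i j \<notin> A \<union> B" using p2' * by simp
      moreover have "j - m < h" using * False by linarith
      then have "p i j \<noteq> z"
        using lev[of "q i m" "q i m" "j - m" h] top[of "q i m"] q(4)[of i] * False p2[of j i]
        by auto
      ultimately show ?thesis using q(1) by blast
    qed
    show "i = i' \<and> j = j'"
      if *: "i < t" "i' < t" "0 < j" "j < m + h" "0 < j'" "j' < m + h" "p i j = p i' j'"
      for i j i' j'
    proof (cases "j \<le> m")
      case True
      then have "j' \<le> m" using p1'[of i j] p2'[of i' j'] * by fastforce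
      then have "q i j = q i' j'" using True * by (simp add: p1)
      then show ?thesis using inj_onD[OF q(6), of "(i, j)" "(i', j')"] True \<open>j' \<le> m\<close> * by auto
    next
      case False
      then have "m < j'" using p1'[of i' j'] p2'[of i j] * by (metis less_imp_le not_le)
      then have eq: "(up ^^ (j - m)) (q i m) = (up ^^ (j' - m)) (q i' m)"
        using * False by (simp add: p2)
      then have "j - m = j' - m"
        using lev[of "q i m" "q i' m" "j - m" "j' - m"] q(4) * by auto
      then have jj: "j = j'" using False \<open>m < j'\<close> by simp
      \<comment> \<open>Climbing \<open>d\<close> more steps from the meeting point leads to height
        \<open>h - 1\<close>, where distinct legs have distinct colours.\<close>
      define d where "d = h - 1 - (j - m)"
      have "(up ^^ (d + (j - m))) (q i m) = (up ^^ (d + (j - m))) (q i' m)"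
        unfolding funpow_add comp_def using eq jj by simp
      moreover have "d + (j - m) = h - 1" using * False by (simp add: d_def)
      ultimately have "(up ^^ (h - 1)) (q i m) = (up ^^ (h - 1)) (q i' m)"
        by simp
      then have "i = i'" using inj_onD[OF q(8), of i i'] * by simp
      then show ?thesis using jj by simp
    qed
  qed
qed (use \<open>B \<noteq> {}\<close> m K in auto)

section \<open>Edges between consecutive layers\<close>

text \<open>The two sides are cleaned differently: elements of \<open>A'\<close> need only a minimum
  degree, whereas each \<open>N b\<close> must keep half of its elements, so that a bound on the
  share of \<open>N b\<close> in any one subtree remains useful after the deletion.\<close>

lemma deletion_core:
  fixes N :: "'b \<Rightarrow> 'c set"
  assumes "finite A" and "finite B" and sub: "\<And>b. b \<in> B \<Longrightarrow> N b \<subseteq> A"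
    and many: "2 * \<delta> * card A < (\<Sum>b\<in>B. card (N b))"
  obtains A' B' where "A' \<subseteq> A" "B' \<subseteq> B" "B' \<noteq> {}"
    "\<And>a. a \<in> A' \<Longrightarrow> \<delta> < card {b \<in> B'. a \<in> N b}"
    "\<And>b. b \<in> B' \<Longrightarrow> card (N b) \<le> 2 * card (N b \<inter> A')"
proof -
  \<comment> \<open>Deleting an element of \<open>A\<close> of degree at most \<open>\<delta>\<close>, or an element of \<open>B\<close> that has lost more
    than half of its neighbours, does not decrease \<open>w\<close>; so a smallest pair with \<open>w > 0\<close> works.\<close>
  define w where "w P = (\<Sum>b\<in>snd P. 2 * int (card (N b \<inter> fst P)) - int (card (N b)))
      - 2 * int \<delta> * int (card (fst P))" for P
  define good where "good P \<longleftrightarrow> fst P \<subseteq> A \<and> snd P \<subseteq> B \<and> 0 < w P" for P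
  have "w (A, B) = (\<Sum>b\<in>B. int (card (N b))) - 2 * int \<delta> * int (card A)"
    using sub unfolding w_def by (auto intro!: sum.cong simp: Int_absorb2)
  also have "\<dots> = int (\<Sum>b\<in>B. card (N b)) - int (2 * \<delta> * card A)"
    by simp
  finally have "w (A, B) = int (\<Sum>b\<in>B. card (N b)) - int (2 * \<delta> * card A)" .
  moreover have "int (2 * \<delta> * card A) < int (\<Sum>b\<in>B. card (N b))"
    using many by (simp only: of_nat_less_iff)
  ultimately have "0 < w (A, B)" by linarith
  then have "good (A, B)" by (simp add: good_def)
  then obtain P where P: "good P"
    and least: "\<And>Q. good Q \<Longrightarrow> card (fst P) + card (snd P) \<le> card (fst Q) + card (snd Q)"
    using ex_has_least_nat[of good "(A, B)" "\<lambda>P. card (fst P) + card (snd P)"] by blast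
  obtain A' B' where AB: "P = (A', B')" by (cases P)
  have sub': "A' \<subseteq> A" "B' \<subseteq> B" and w: "0 < w (A', B')"
    using P by (auto simp: good_def AB)
  have fin: "finite A'" "finite B'"
    using sub' assms finite_subset by blast+
  show ?thesis
  proof (rule that[OF sub'])
    show "B' \<noteq> {}"
    proof
      assume "B' = {}"
      then have "2 * int \<delta> * int (card A') < 0" using w by (simp add: w_def)
      moreover have "0 \<le> 2 * int \<delta> * int (card A')" by simp
      ultimately show False by linarith
    qed
    show "card (N b) \<le> 2 * card (N b \<inter> A')" if b: "b \<in> B'" for b
    proof (rule ccontr)
      assume "\<not> ?thesis"
      then have "w (A', B') < w (A', B' - {b})"
        using fin b by (simp add: w_def sum.remove[of B' b])
      then have "good (A', B' - {b})" using sub' w by (auto simp: good_def)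
      then have "card B' \<le> card (B' - {b})" using least by (fastforce simp: AB)
      then show False using fin b by (meson card_Diff1_less not_le)
    qed
    show "\<delta> < card {b \<in> B'. a \<in> N b}" if a: "a \<in> A'" for a
    proof (rule ccontr)
      assume le: "\<not> ?thesis"
      have one: "card (N b \<inter> A') = card (N b \<inter> (A' - {a})) + of_bool (a \<in> N b)" for b
      proof (cases "a \<in> N b")
        case True
        then have "N b \<inter> A' = insert a (N b \<inter> (A' - {a}))" using a by auto
        then show ?thesis using fin True by simp
      next
        case False
        then have "N b \<inter> A' = N b \<inter> (A' - {a})" by auto
        then show ?thesis using False by simp
      qed
      \<comment> \<open>Removing \<open>a\<close> lowers the sum by twice its degree, hence by at
        most \<open>2 * \<delta>\<close>, which is exactly what the penalty term of \<open>w\<close>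
        gives back.\<close>
      have "(\<Sum>b\<in>B'. 2 * int (card (N b \<inter> A')) - int (card (N b)))
          = (\<Sum>b\<in>B'. (2 * int (card (N b \<inter> (A' - {a}))) - int (card (N b)))
              + 2 * (if a \<in> N b then 1 else 0))"
        by (intro sum.cong) (auto simp: one)
      also have "\<dots> = (\<Sum>b\<in>B'. 2 * int (card (N b \<inter> (A' - {a}))) - int (card (N b)))
          + 2 * int (card {b \<in> B'. a \<in> N b})"
        using fin by (simp add: sum.distrib sum_distrib_left[symmetric] sum.If_cases
            Collect_conj_eq Int_commute)
      finally have sum: "(\<Sum>b\<in>B'. 2 * int (card (N b \<inter> A')) - int (card (N b)))
          = (\<Sum>b\<in>B'. 2 * int (card (N b \<inter> (A' - {a}))) - int (card (N b)))
            + 2 * int (card {b \<in> B'. a \<in> N b})" .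
      have "card A' = card (A' - {a}) + 1" using card.remove[OF fin(1) a] by simp
      then have "2 * int \<delta> * int (card A') = 2 * int \<delta> * int (card (A' - {a})) + 2 * int \<delta>"
        by (simp add: distrib_left)
      then have "w (A', B') = w (A' - {a}, B') + 2 * int (card {b \<in> B'. a \<in> N b}) - 2 * int \<delta>"
        using sum unfolding w_def fst_conv snd_conv by linarith
      then have "good (A' - {a}, B')" using le sub' w by (auto simp: good_def)
      then have "card A' \<le> card (A' - {a})" using least by (fastforce simp: AB)
      then show False using fin a by (meson card_Diff1_less not_le)
    qed
  qed
qed

text \<open>
  Seen as the parent function of a tree with all of \<open>N\<close> at depth \<open>h\<close> below \<open>z\<close>: walk from \<open>z\<close>
  down into any child that keeps a fraction \<open>1 / s\<close> of the current set, and stop when there is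
  none. The case \<open>h' = 0\<close> means that the walk has reached a leaf.
\<close>

lemma concentrate:
  assumes "finite N" and "N \<noteq> {}" and "s \<ge> 1" and "\<And>a. a \<in> N \<Longrightarrow> (f ^^ h) a = z"
  shows "\<exists>h' N' z'. h' \<le> h \<and> N' \<subseteq> N \<and> N' \<noteq> {} \<and> (\<forall>a\<in>N'. (f ^^ h') a = z') \<and>
      card N \<le> s ^ h * card N' \<and>
      (h' = 0 \<or> (\<forall>c. s * card {a \<in> N'. (f ^^ (h' - 1)) a = c} < card N'))"
  using assms
proof (induction h arbitrary: N z)
  case 0
  have "card N \<le> s ^ 0 * card N" by simp
  with 0 show ?case by blast
next
  case (Suc h)
  show ?case
  proof (cases "\<forall>c. s * card {a \<in> N. (f ^^ h) a = c} < card N")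
    case True
    moreover have "card N \<le> s ^ Suc h * card N" using \<open>s \<ge> 1\<close> by simp
    ultimately show ?thesis
      using Suc.prems by (intro exI[of _ "Suc h"] exI[of _ N] exI[of _ z] conjI) simp_all
  next
    case False
    then obtain c where c: "card N \<le> s * card {a \<in> N. (f ^^ h) a = c}"
      by (auto simp: not_less)
    let ?M = "{a \<in> N. (f ^^ h) a = c}"
    have "0 < card N" using Suc.prems by (simp add: card_gt_0_iff)
    then have "?M \<noteq> {}" using c by (metis card.empty mult_0_right not_le)
    moreover have "finite ?M" and "\<And>a. a \<in> ?M \<Longrightarrow> (f ^^ h) a = c"
      using Suc.prems(1) by simp_all
    ultimately obtain h' N' z' where *: "h' \<le> h" "N' \<subseteq> ?M" "N' \<noteq> {}" "\<forall>a\<in>N'. (f ^^ h') a = z'"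
      "card ?M \<le> s ^ h * card N'"
      "h' = 0 \<or> (\<forall>c. s * card {a \<in> N'. (f ^^ (h' - 1)) a = c} < card N')"
      using Suc.IH[of ?M c] Suc.prems(3) by blast
    have "card N \<le> s * (s ^ h * card N')"
      using c *(5) mult_le_mono2 order_trans by blast
    then show ?thesis
      using * by (intro exI[of _ h'] exI[of _ N'] exI[of _ z'] conjI) (simp_all, blast)
  qed
qed

lemma finite_rel_Image:
  assumes "finite E"
  shows "finite (E `` S)"
  by (rule finite_subset[of _ "snd ` E"]) (use assms in force)+

text \<open>
  \<open>V\<close> and \<open>up\<close> are the layers and the parent function of a breadth-first search tree. The edges
  inside \<open>V l\<close> are included, so that the graph need not be bipartite.
\<close>

lemma layer_edges_bound:
  fixes V :: "nat \<Rightarrow> 'a set" and up :: "'a \<Rightarrow> 'a"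
  assumes "sym E" and fin: "\<And>j. finite (V j)"
    and disj: "\<And>i j. i \<noteq> j \<Longrightarrow> V i \<inter> V j = {}" and root: "V 0 = {x}"
    and up: "\<And>j v. v \<in> V (Suc j) \<Longrightarrow> up v \<in> V j \<and> (v, up v) \<in> E"
    and free: "\<not> has_theta E k t" and t: "t \<ge> 1" and l: "l < k"
    and K: "K = t * k + 1"
  shows "card (E \<inter> (V l \<union> V (Suc l)) \<times> V l)
    \<le> (4 * K) ^ k * (4 * K + 2 * K * k) * (card (V l) + card (V l \<union> V (Suc l)))"
proof (rule ccontr)
  assume contr: "\<not> ?thesis"
  \<comment> \<open>With this \<open>s\<close>, any \<open>K\<close> child subtrees contain at most
    a quarter of \<open>N b\<close>, and \<open>K\<close> single vertices make up less than a
    quarter since \<open>card (N b)\<close> exceeds \<open>s\<close>. The half of \<open>N b\<close>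
    that survives the deletion is larger than both together.\<close>
  define s where "s = 4 * K"
  define B where "B = V l \<union> V (Suc l)"
  define R where "R = E \<inter> B \<times> V l"
  \<comment> \<open>Concentrating the neighbours of \<open>b\<close> below one apex may cost a
    factor \<open>s ^ l\<close>; above this threshold more than \<open>s\<close> of them are still
    left.\<close>
  define B0 where "B0 = {b \<in> B. s ^ l * s < card (R `` {b})}"
  have s1: "s \<ge> 1" using K by (simp add: s_def)
  have finB: "finite B" "finite B0" using fin by (auto simp: B_def B0_def)
  have finR: "finite R" using fin finB(1) unfolding R_def by blast
  have Rsub: "R `` {b} \<subseteq> V l" for b by (auto simp: R_def)
  have anc: "(up ^^ j) a \<in> V (l - j)" if "a \<in> V l" "j \<le> l" for a j
    using that
  proof (induction j)
    case (Suc j)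
    then have "(up ^^ j) a \<in> V (Suc (l - Suc j))" by (simp add: Suc_diff_Suc)
    then show ?case using up by simp
  qed simp
  have anc_edge: "((up ^^ j) a, (up ^^ Suc j) a) \<in> E" if "a \<in> V l" "j < l" for a j
  proof -
    have "(up ^^ j) a \<in> V (Suc (l - Suc j))" using anc[of a j] that by (simp add: Suc_diff_Suc)
    then show ?thesis using up by simp
  qed
  define P where "P b h' N' z' \<longleftrightarrow> h' \<le> l \<and> N' \<subseteq> R `` {b} \<and> N' \<noteq> {} \<and>
      (\<forall>a\<in>N'. (up ^^ h') a = z') \<and> card (R `` {b}) \<le> s ^ l * card N' \<and>
      (h' = 0 \<or> (\<forall>c. s * card {a \<in> N'. (up ^^ (h' - 1)) a = c} < card N'))" for b h' N' z'
  have "\<exists>h' N' z'. P b h' N' z'"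
    if "b \<in> B0" for b
    unfolding P_def
  proof (rule concentrate)
    show "finite (R `` {b})" by (rule finite_subset[OF Rsub fin])
    have "0 < card (R `` {b})" using that by (simp add: B0_def)
    then show "R `` {b} \<noteq> {}" by (metis card.empty less_numeral_extra(3))
    show "1 \<le> s" by (rule s1)
    show "(up ^^ l) a = x" if "a \<in> R `` {b}" for a
    proof -
      have "a \<in> V l" using that Rsub by blast
      then have "(up ^^ l) a \<in> V (l - l)" by (rule anc) simp
      then show ?thesis by (simp add: root)
    qed
  qed
  then obtain H N Z where *: "P b (H b) (N b) (Z b)" if "b \<in> B0" for b
    by metis
  then have Hl: "H b \<le> l" and NR: "N b \<subseteq> R `` {b}" and NZ: "\<And>a. a \<in> N b \<Longrightarrow> (up ^^ (H b)) a = Z b"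
    and RN: "card (R `` {b}) \<le> s ^ l * card (N b)"
    and bal: "H b = 0 \<or> (\<forall>c. s * card {a \<in> N b. (up ^^ (H b - 1)) a = c} < card (N b))"
    if "b \<in> B0" for b
    using *[OF that] unfolding P_def by blast+
  have finN: "finite (N b)" if "b \<in> B0" for b
    using finite_subset[OF NR[OF that]] finite_subset[OF Rsub fin] by blast
  have bigN: "s < card (N b)" if "b \<in> B0" for b
  proof -
    have "s ^ l * s < card (R `` {b})" using that by (simp add: B0_def)
    also note RN[OF that]
    finally have "s ^ l * s < s ^ l * card (N b)" .
    then show ?thesis using s1 by simp
  qed
  \<comment> \<open>At height 0 every element of \<open>N b\<close> is itself the apex, so
    \<open>N b\<close> would have at most one element.\<close>
  have Hpos: "H b \<ge> 1" if "b \<in> B0" for b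
  proof (rule ccontr)
    assume "\<not> ?thesis"
    then have "H b = 0" by simp
    then have "N b \<subseteq> {Z b}" using NZ[OF that] by (simp add: subset_iff)
    then have "card (N b) \<le> 1" using card_mono[of "{Z b}" "N b"] by simp
    then show False using bigN[OF that] s1 by simp
  qed
  have bal': "s * card {a \<in> N b. (up ^^ (H b - 1)) a = c} < card (N b)" if "b \<in> B0" for b c
    using bal[OF that] Hpos[OF that] by auto
  \<comment> \<open>Tagging the neighbours of \<open>b\<close> with the height \<open>H b\<close> separates the heights, and for a fixed
    height the apex \<open>Z b\<close> is determined by any neighbour; so a connected piece has a single apex.\<close>
  define N' where "N' b = N b \<times> {H b}" for b
  have cN': "card (N' b) = card (N b)" for b by (simp add: N'_def card_cartesian_product)
  \<comment> \<open>Otherwise the edges at vertices outside \<open>B0\<close>, at most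
    \<open>s ^ l * s\<close> each, and those at \<open>B0\<close>, at most \<open>s ^ l\<close> per
    element of \<open>N b\<close>, add up to no more than the claimed bound.\<close>
  have many: "2 * K * card (V l \<times> {..<k}) < (\<Sum>b\<in>B0. card (N' b))"
  proof (rule ccontr)
    assume "\<not> ?thesis"
    then have few: "(\<Sum>b\<in>B0. card (N b)) \<le> 2 * K * k * card (V l)"
      by (simp add: cN' card_cartesian_product mult_ac)
    have sl: "s ^ l \<le> s ^ k" using s1 l by (intro power_increasing) auto
    have "R = (SIGMA b:B. R `` {b})" by (auto simp: R_def)
    then have "card R = (\<Sum>b\<in>B. card (R `` {b}))"
      using finB(1) finite_subset[OF Rsub fin] card_SigmaI[of B "\<lambda>b. R `` {b}"] by metis
    also have "\<dots> = (\<Sum>b\<in>B - B0. card (R `` {b})) + (\<Sum>b\<in>B0. card (R `` {b}))"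
      using finB by (intro sum.subset_diff) (auto simp: B0_def)
    also have "\<dots> \<le> (\<Sum>b\<in>B - B0. s ^ l * s) + (\<Sum>b\<in>B0. s ^ l * card (N b))"
      using RN by (intro add_mono sum_mono) (auto simp: B0_def)
    also have "\<dots> \<le> card B * (s ^ l * s) + s ^ l * (2 * K * k * card (V l))"
      unfolding sum_distrib_left[symmetric]
      using few card_mono[OF finB(1), of "B - B0"] by (intro add_mono mult_le_mono2) (auto intro: mult_le_mono1)
    also have "\<dots> = s ^ l * (s * card B + 2 * K * k * card (V l))"
      by (simp add: algebra_simps)
    also have "\<dots> \<le> s ^ k * ((s + 2 * K * k) * (card (V l) + card B))"
      using sl by (intro mult_le_mono) (simp_all add: algebra_simps)
    finally show False using contr by (simp add: R_def B_def s_def mult.assoc)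
  qed
  have sub: "N' b \<subseteq> V l \<times> {..<k}" if "b \<in> B0" for b
    using NR[OF that] Rsub Hl[OF that] l by (auto simp: N'_def)
  obtain A1 B1 where A1: "A1 \<subseteq> V l \<times> {..<k}" and B1: "B1 \<subseteq> B0" "B1 \<noteq> {}"
    and degA: "\<And>a. a \<in> A1 \<Longrightarrow> K < card {b \<in> B1. a \<in> N' b}"
    and degB: "\<And>b. b \<in> B1 \<Longrightarrow> card (N' b) \<le> 2 * card (N' b \<inter> A1)"
    using deletion_core[of "V l \<times> {..<k}" B0 N' K] fin finB sub many by blast
  obtain b0 where b0: "b0 \<in> B1" using B1 by blast
  define h where "h = H b0"
  define z where "z = Z b0"
  define SA where "SA = {a. (a, h) \<in> A1 \<and> (up ^^ h) a = z}"
  define SB where "SB = {b \<in> B1. H b = h \<and> Z b = z}"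
  have h: "1 \<le> h" "h \<le> l" using Hpos Hl b0 B1 by (auto simp: h_def)
  have SA: "a \<in> V l" if "a \<in> SA" for a using that A1 by (auto simp: SA_def)
  have SB: "b \<in> B0" "b \<in> B" "H b = h" "Z b = z" "b \<in> B1" if "b \<in> SB" for b
    using that B1 by (auto simp: SB_def B0_def)
  \<comment> \<open>The legs have positive length because \<open>h \<le> l < k\<close>.\<close>
  have "has_theta E ((k - h) + h) t"
  proof (rule spider_theta[where A = SA and B = SB and up = up and h = h and z = z and K = K])
    fix a X assume a: "a \<in> SA" and X: "finite (X :: 'a set)" "card X \<le> K"
    let ?D = "{b \<in> B1. (a, h) \<in> N' b}"
    have "card X < card ?D" using degA[of "(a, h)"] a X by (auto simp: SA_def)
    then have "\<not> ?D \<subseteq> X" using card_mono[OF X(1)] by (meson not_le)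
    then obtain b where b: "b \<in> B1" "(a, h) \<in> N' b" "b \<notin> X" by auto
    then have "a \<in> N b" "H b = h" by (auto simp: N'_def)
    then have "Z b = z" "(b, a) \<in> E"
      using NZ[of b a] NR[of b] a b B1 by (auto simp: SA_def R_def)
    then show "\<exists>b\<in>SB. (a, b) \<in> E \<and> b \<notin> X"
      using b \<open>H b = h\<close> \<open>sym E\<close> by (auto simp: SB_def dest: symD)
  next
    fix b and X Y :: "'a set"
    assume b: "b \<in> SB" and XY: "finite X" "card X \<le> K" "finite Y" "card Y \<le> K"
    let ?M = "{a \<in> N b. (a, h) \<in> A1}"
    let ?C = "\<lambda>c. {a \<in> N b. (up ^^ (h - 1)) a = c}"
    have "N' b \<inter> A1 = ?M \<times> {h}" using SB(3)[OF b] by (auto simp: N'_def)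
    then have half: "card (N b) \<le> 2 * card ?M"
      using degB[of b] SB(5)[OF b] cN' by (simp add: card_cartesian_product)
    have C: "s * card (?C c) \<le> card (N b)" for c
      using bal'[OF SB(1)[OF b], of c] SB(3)[OF b] by simp
    have "s * card (\<Union>c\<in>Y. ?C c) \<le> s * (\<Sum>c\<in>Y. card (?C c))"
      using XY by (intro mult_le_mono2 card_UN_le)
    also have "\<dots> \<le> (\<Sum>c\<in>Y. card (N b))"
      unfolding sum_distrib_left using C by (intro sum_mono)
    also have "\<dots> \<le> K * card (N b)" using XY by simp
    finally have "K * (4 * card (\<Union>c\<in>Y. ?C c)) \<le> K * card (N b)" by (simp add: s_def mult_ac)
    then have U: "4 * card (\<Union>c\<in>Y. ?C c) \<le> card (N b)"
      using nat_mult_le_cancel1[of K] by (simp only: K)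
    have "card (X \<union> (\<Union>c\<in>Y. ?C c)) \<le> card X + card (\<Union>c\<in>Y. ?C c)" by (rule card_Un_le)
    also have "\<dots> < card ?M" using U half bigN[OF SB(1)[OF b]] XY by (simp add: s_def)
    finally have lt: "card (X \<union> (\<Union>c\<in>Y. ?C c)) < card ?M" .
    have "finite (X \<union> (\<Union>c\<in>Y. ?C c))" using XY finN[OF SB(1)[OF b]] by auto
    then have "\<not> ?M \<subseteq> X \<union> (\<Union>c\<in>Y. ?C c)" using lt card_mono by (meson not_le)
    then obtain a where a: "a \<in> N b" "(a, h) \<in> A1" "a \<notin> X" "(up ^^ (h - 1)) a \<notin> Y" by auto
    have "(up ^^ h) a = z" using NZ[of b a] SB[OF b] a by simp
    moreover have "(b, a) \<in> E" using NR[of b] SB[OF b] a by (auto simp: R_def)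
    ultimately show "\<exists>a\<in>SA. (b, a) \<in> E \<and> a \<notin> X \<and> (up ^^ (h - 1)) a \<notin> Y"
      using a by (auto simp: SA_def)
  next
    show "SB \<noteq> {}" using b0 by (auto simp: SB_def h_def z_def)
    show "1 \<le> k - h" using h l by simp
    show "t * (k - h) + 1 \<le> K" by (simp add: K)
    show "1 \<le> h" "1 \<le> t" using h t by auto
    show "((up ^^ j) a, (up ^^ Suc j) a) \<in> E" if "a \<in> SA" "j < h" for a j
      using anc_edge[of a j] SA that h by simp
    show "(up ^^ j) a \<notin> SA \<union> SB" if "a \<in> SA" "1 \<le> j" "j \<le> h" for a j
    proof -
      have "(up ^^ j) a \<in> V (l - j)" using anc SA that h by simp
      moreover have "V (l - j) \<inter> V l = {}" "V (l - j) \<inter> V (Suc l) = {}"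
        using that h by (intro disj; simp)+
      ultimately show ?thesis using SA SB(2) unfolding B_def by blast
    qed
    show "(up ^^ h) a = z" if "a \<in> SA" for a using that by (simp add: SA_def)
    show "j = j'" if "a \<in> SA" "a' \<in> SA" "j \<le> h" "j' \<le> h" "(up ^^ j) a = (up ^^ j') a'" for a a' j j'
    proof (rule ccontr)
      assume "j \<noteq> j'"
      then have "V (l - j) \<inter> V (l - j') = {}" using that h by (intro disj) simp
      then show False using anc[of a j] anc[of a' j'] SA that h by auto
    qed
  qed
  then show False using free h l by simp
qed

section \<open>Theta-free graphs\<close>

text \<open>Each vertex of a breadth-first layer sends its at least \<open>d\<close> edges to the
  previous, the same or the next layer, and \<open>layer_edges_bound\<close> caps all of these by
  layer sizes. So the next layer is larger by a factor \<open>d / c - 5\<close>. With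
  \<open>y = d / (6 * c)\<close> this is \<open>6 * y - 5\<close>, at least \<open>y\<close> as
  \<open>y \<ge> 1\<close>.\<close>

lemma min_degree_bound:
  fixes E :: "('a \<times> 'a) set" and d :: real and c :: nat
  assumes "finite W" and EW: "E \<subseteq> W \<times> W" and "sym E" and free: "\<not> has_theta E k t"
    and t: "t \<ge> 1" and c: "c = (4 * (t * k + 1)) ^ k * (4 * (t * k + 1) + 2 * (t * k + 1) * k)"
    and x: "x \<in> W" and deg: "\<And>v. v \<in> W \<Longrightarrow> d \<le> card (E `` {v})" and d: "6 * real c \<le> d"
  shows "(d / (6 * real c)) ^ k \<le> card W"
proof -
  define V where "V j = {v. (x, v) \<in> E ^^ j \<and> (\<forall>i<j. (x, v) \<notin> E ^^ i)}" for j
  have VW: "V j \<subseteq> W" for j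
  proof -
    have "v \<in> W" if "(x, v) \<in> E ^^ j" for v
      using that x EW by (cases j) auto
    then show ?thesis by (auto simp: V_def)
  qed
  have finV: "finite (V j)" for j using VW \<open>finite W\<close> finite_subset by blast
  have disj: "V i \<inter> V j = {}" if "i \<noteq> j" for i j
    using that by (auto simp: V_def) (metis nat_neq_iff)
  have V0: "V 0 = {x}" by (auto simp: V_def)
  have "\<exists>w. w \<in> V j \<and> (v, w) \<in> E" if "v \<in> V (Suc j)" for v j
  proof -
    obtain w where w: "(x, w) \<in> E ^^ j" "(w, v) \<in> E" using \<open>v \<in> V (Suc j)\<close> by (auto simp: V_def)
    have "(x, w) \<notin> E ^^ i" if "i < j" for i
    proof
      assume "(x, w) \<in> E ^^ i"
      then have "(x, v) \<in> E ^^ Suc i" using w(2) by auto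
      then show False using \<open>v \<in> V (Suc j)\<close> \<open>i < j\<close> unfolding V_def by blast
    qed
    then show ?thesis using w \<open>sym E\<close> by (auto simp: V_def dest: symD)
  qed
  \<comment> \<open>The layers are disjoint, so one parent function can serve all of them.\<close>
  then have "\<exists>w. \<forall>j. v \<in> V (Suc j) \<longrightarrow> w \<in> V j \<and> (v, w) \<in> E" for v
    using disj by (metis disjoint_iff nat.inject)
  then obtain up where up: "v \<in> V (Suc j) \<Longrightarrow> up v \<in> V j \<and> (v, up v) \<in> E" for v j
    by metis
  have near: "w \<in> V (l - 1) \<union> V l \<union> V (Suc l)" if v: "v \<in> V l" "(v, w) \<in> E" for v w l
  proof -
    have "(x, w) \<in> E ^^ Suc l" using v by (auto simp: V_def)
    define i where "i = (LEAST i. (x, w) \<in> E ^^ i)"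
    have i: "(x, w) \<in> E ^^ i" unfolding i_def by (rule LeastI) fact
    have "i \<le> Suc l" unfolding i_def by (rule Least_le) fact
    moreover have "w \<in> V i" using i not_less_Least unfolding V_def i_def by blast
    moreover have "(x, v) \<in> E ^^ Suc i" using i v(2) \<open>sym E\<close> by (auto dest: symD)
    then have "\<not> Suc i < l" using v(1) unfolding V_def by blast
    moreover from calculation have "i = l - 1 \<or> i = l \<or> i = Suc l" by linarith
    ultimately show ?thesis by blast
  qed
  have cpos: "0 < c" by (simp add: c)
  have layer: "card (E \<inter> (V l \<union> V (Suc l)) \<times> V l) \<le> c * (2 * card (V l) + card (V (Suc l)))"
    if "l < k" for l
  proof -
    have "card (E \<inter> (V l \<union> V (Suc l)) \<times> V l) \<le> c * (card (V l) + card (V l \<union> V (Suc l)))"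
      unfolding c by (rule layer_edges_bound[where V = V and up = up and x = x, OF \<open>sym E\<close> finV disj V0 up free t that refl])
    also have "\<dots> \<le> c * (2 * card (V l) + card (V (Suc l)))"
      using card_Un_le[of "V l" "V (Suc l)"] by (intro mult_le_mono2) simp
    finally show ?thesis .
  qed
  \<comment> \<open>The 5 is 2 + 3: edges within \<open>V l\<close> or forward cost
    \<open>2 * card (V l)\<close> besides the next layer, and edges backward cost at most
    \<open>3 * card (V l)\<close> by \<open>mono\<close>.\<close>
  have growth: "d * card (V l) \<le> c * (5 * card (V l) + card (V (Suc l)))"
    if l: "l < k" and mono: "card (V (l - 1)) \<le> card (V l)" for l
  proof -
    define S where "S = E \<inter> (V l \<union> V (Suc l)) \<times> V l"
    \<comment> \<open>There is no earlier layer at \<open>l = 0\<close>, where \<open>l - 1\<close>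
      would be \<open>0\<close> again.\<close>
    define T where "T = (if l = 0 then {} else E \<inter> (V (l - 1) \<union> V l) \<times> V (l - 1))"
    have fin: "finite S" "finite T"
      using finV by (auto simp: S_def T_def)
    have cT: "card T \<le> c * (3 * card (V l))"
    proof (cases "l = 0")
      case False
      then have "card T \<le> c * (2 * card (V (l - 1)) + card (V l))"
        using layer[of "l - 1"] l by (simp add: T_def)
      also have "\<dots> \<le> c * (3 * card (V l))" using mono by (intro mult_le_mono2) simp
      finally show ?thesis .
    qed (simp add: T_def)
    have "(SIGMA v:V l. E `` {v}) \<subseteq> prod.swap ` S \<union> T"
    proof clarify
      fix v w assume *: "v \<in> V l" "(v, w) \<in> E" "(v, w) \<notin> T"
      then have "w \<in> V l \<union> V (Suc l)" using near[OF *(1,2)] by (auto simp: T_def split: if_splits)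
      moreover have "(w, v) \<in> E" using * \<open>sym E\<close> by (auto dest: symD)
      ultimately have "(w, v) \<in> S" using * by (auto simp: S_def)
      then show "(v, w) \<in> prod.swap ` S" by force
    qed
    then have "card (SIGMA v:V l. E `` {v}) \<le> card (prod.swap ` S \<union> T)"
      using fin by (intro card_mono) auto
    also have "\<dots> \<le> card (prod.swap ` S) + card T" by (rule card_Un_le)
    also have "\<dots> \<le> card S + card T" using card_image_le[OF fin(1)] by simp
    also have "\<dots> \<le> c * (2 * card (V l) + card (V (Suc l))) + c * (3 * card (V l))"
      using layer[OF l] cT by (simp add: S_def)
    also have "\<dots> = c * (5 * card (V l) + card (V (Suc l)))" by (simp add: algebra_simps)
    finally have le: "card (SIGMA v:V l. E `` {v}) \<le> c * (5 * card (V l) + card (V (Suc l)))" .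
    have "E `` {v} \<subseteq> W" for v using EW by auto
    then have "finite (E `` {v})" for v using \<open>finite W\<close> finite_subset by blast
    then have "card (SIGMA v:V l. E `` {v}) = (\<Sum>v\<in>V l. card (E `` {v}))"
      using finV by (intro card_SigmaI) auto
    moreover have "d * card (V l) \<le> (\<Sum>v\<in>V l. real (card (E `` {v})))"
      using deg VW sum_bounded_below[of "V l" d "\<lambda>v. real (card (E `` {v}))"]
      by (auto simp: mult.commute)
    ultimately have "d * card (V l) \<le> real (card (SIGMA v:V l. E `` {v}))" by simp
    also have "\<dots> \<le> real (c * (5 * card (V l) + card (V (Suc l))))" using le by (rule of_nat_mono)
    finally show ?thesis by simp
  qed
  define y where "y = d / (6 * real c)"
  have y: "1 \<le> y" "d = 6 * real c * y" using d cpos by (auto simp: y_def)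
  \<comment> \<open>Monotonicity of the layer sizes is carried along because \<open>growth\<close>
    requires it; at \<open>l = 0\<close> it is trivial.\<close>
  have "y ^ l \<le> card (V l) \<and> card (V (l - 1)) \<le> card (V l)" if "l \<le> k" for l
    using that
  proof (induction l)
    case 0
    then show ?case by (simp add: V0)
  next
    case (Suc l)
    then have IH: "y ^ l \<le> card (V l)" "card (V (l - 1)) \<le> card (V l)" by auto
    have "real c * (6 * (y * card (V l))) \<le> real c * (5 * real (card (V l)) + real (card (V (Suc l))))"
      using growth[of l] Suc.prems IH y(2) by (simp add: mult_ac)
    then have "6 * (y * card (V l)) \<le> 5 * real (card (V l)) + real (card (V (Suc l)))"
      using cpos by (simp only: mult_le_cancel_left_pos of_nat_0_less_iff)
    moreover have "1 * real (card (V l)) \<le> y * card (V l)" using y by (intro mult_right_mono) auto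
    ultimately have *: "y * card (V l) \<le> card (V (Suc l))" "real (card (V l)) \<le> card (V (Suc l))"
      by linarith+
    have "y ^ Suc l \<le> y * card (V l)" using IH y by simp
    then show ?case using * by simp
  qed
  then have "y ^ k \<le> card (V k)" by simp
  also have "\<dots> \<le> card W" using card_mono[OF \<open>finite W\<close> VW] by simp
  finally show ?thesis by (simp add: y_def)
qed

text \<open>Suppose the bound fails, and let \<open>r ^ k = card V\<close>. A smallest
  \<open>W\<close> with more than \<open>24 * c * r * card W\<close> ordered edges has minimum
  degree at least \<open>12 * c * r\<close>, since deleting \<open>v\<close> loses at most twice its
  degree. Then \<open>min_degree_bound\<close> yields
  \<open>(2 * r) ^ k \<le> card W \<le> card V\<close>, which is absurd.\<close>

lemma theta_free_edges:
  assumes k: "k \<ge> 1" and t: "t \<ge> 1"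
  shows "\<exists>C::real. \<forall>V (E :: ('a \<times> 'a) set). finite V \<longrightarrow> E \<subseteq> V \<times> V \<longrightarrow> sym E \<longrightarrow>
    \<not> has_theta E k t \<longrightarrow> card E \<le> C * card V powr (1 + 1 / k)"
proof -
  define c where "c = (4 * (t * k + 1)) ^ k * (4 * (t * k + 1) + 2 * (t * k + 1) * k)"
  have cpos: "0 < c" by (simp add: c_def)
  have "card E \<le> 24 * real c * card V powr (1 + 1 / k)"
    if "finite V" "E \<subseteq> V \<times> V" "sym E" and free: "\<not> has_theta E k t" for V and E :: "('a \<times> 'a) set"
  proof (rule ccontr)
    assume contr: "\<not> ?thesis"
    define r where "r = card V powr (1 / k)"
    have V: "V \<noteq> {}" using that(2) contr by auto
    then have n: "1 \<le> card V" using that(1) by (simp add: Suc_le_eq card_gt_0_iff)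
    have r1: "1 \<le> r" using n by (simp add: r_def ge_one_powr_ge_zero)
    have rk: "r ^ k = card V" using n k by (simp add: r_def powr_realpow[symmetric] powr_powr)
    have "card V powr (1 + 1 / k) = card V * r" using n by (simp add: r_def powr_add)
    then have big: "24 * real c * r * card V < card E" using contr by (simp add: mult_ac)
    define Q where "Q W \<longleftrightarrow> W \<subseteq> V \<and> 24 * real c * r * card W < card (E \<inter> W \<times> W)" for W
    have "E \<inter> V \<times> V = E" using that(2) by blast
    then have "Q V" using big by (simp add: Q_def)
    then obtain W where W: "Q W" and least: "\<And>W'. Q W' \<Longrightarrow> card W \<le> card W'"
      using ex_has_least_nat[of Q V card] by blast
    define E' where "E' = E \<inter> W \<times> W"
    have WV: "W \<subseteq> V" using W by (simp add: Q_def)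
    have finW: "finite W" using WV that(1) finite_subset by blast
    then have finE': "finite E'" by (simp add: E'_def)
    have "W \<noteq> {}" using W by (auto simp: Q_def)
    then obtain x where x: "x \<in> W" by blast
    have "(12 * real c * r / (6 * real c)) ^ k \<le> card W"
    proof (rule min_degree_bound[where E = E', OF finW _ _ _ t c_def x])
      show "E' \<subseteq> W \<times> W" by (simp add: E'_def)
      show "sym E'" using \<open>sym E\<close> by (auto simp: E'_def sym_def)
      show "\<not> has_theta E' k t" using free has_theta_mono[of E' k t E] by (auto simp: E'_def)
      show "6 * real c \<le> 12 * real c * r" using r1 cpos by simp
      fix v assume v: "v \<in> W"
      have "card (W - {v}) < card W" using v finW by (meson card_Diff1_less)
      then have "\<not> Q (W - {v})" using least by fastforce
      then have "card (E \<inter> (W - {v}) \<times> (W - {v})) \<le> 24 * real c * r * card (W - {v})"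
        using WV by (auto simp: Q_def)
      moreover have "real (card W) = card (W - {v}) + 1" using card.remove[OF finW v] by simp
      then have "24 * real c * r * card W = 24 * real c * r * card (W - {v}) + 24 * real c * r"
        by (simp add: distrib_left)
      moreover have "24 * real c * r * card W < card E'" using W by (simp add: Q_def E'_def)
      moreover have "card E' \<le> card (E \<inter> (W - {v}) \<times> (W - {v})) + 2 * card (E' `` {v})"
      proof -
        let ?N = "E' `` {v}"
        have fin: "finite ?N" using finE' finite_rel_Image by blast
        have "E' \<subseteq> (E \<inter> (W - {v}) \<times> (W - {v})) \<union> ({v} \<times> ?N \<union> ?N \<times> {v})"
          using \<open>sym E\<close> by (auto simp: E'_def dest: symD)
        then have "card E' \<le> card ((E \<inter> (W - {v}) \<times> (W - {v})) \<union> ({v} \<times> ?N \<union> ?N \<times> {v}))"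
          using fin finW by (intro card_mono) auto
        also have "\<dots> \<le> card (E \<inter> (W - {v}) \<times> (W - {v})) + card ({v} \<times> ?N \<union> ?N \<times> {v})"
          by (rule card_Un_le)
        also have "card ({v} \<times> ?N \<union> ?N \<times> {v}) \<le> card ({v} \<times> ?N) + card (?N \<times> {v})"
          by (rule card_Un_le)
        finally show ?thesis by (simp add: card_cartesian_product)
      qed
      then have "real (card E') \<le> card (E \<inter> (W - {v}) \<times> (W - {v})) + 2 * real (card (E' `` {v}))"
        by linarith
      ultimately show "12 * real c * r \<le> card (E' `` {v})" by linarith
    qed
    moreover have "12 * real c * r / (6 * real c) = 2 * r" using cpos by simp
    ultimately have "2 ^ k * real (card V) \<le> card W" by (simp add: power_mult_distrib rk)
    also have "\<dots> \<le> card V" using card_mono[OF that(1) WV] by simp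
    finally have "2 ^ k * real (card V) \<le> 1 * real (card V)" by simp
    then have "(2::real) ^ k \<le> 1" using n by (simp del: mult_1)
    moreover have "(2::real) ^ 1 \<le> 2 ^ k" using k by (intro power_increasing) auto
    ultimately show False by simp
  qed
  then show ?thesis by blast
qed

section \<open>Berge theta-free hypergraphs\<close>

text \<open>The Berge copy keeps all vertices of \<open>H\<close>, so the identity embeds it. That
  \<open>f\<close> maps into \<open>verts H\<close> follows because every vertex of the theta graph
  lies on an edge.\<close>

lemma contains_berge_theta:
  fixes H :: "nat hypergraph"
  assumes H: "uniform_hypergraph r H" and k: "k \<ge> 1"
    and f: "inj_on f (verts (theta_graph k t))"
    and \<phi>: "inj_on \<phi> (edges (theta_graph k t))"
      "\<And>e. e \<in> edges (theta_graph k t) \<Longrightarrow> \<phi> e \<in> edges H \<and> f ` e \<subseteq> \<phi> e"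
  shows "\<exists>G\<in>berge_family r (theta_graph k t). contains_copy H G"
proof
  let ?F = "theta_graph k t"
  let ?G = "\<lparr>verts = verts H, edges = \<phi> ` edges ?F\<rparr>"
  have "f v \<in> verts H" if v: "v \<in> verts ?F" for v
  proof -
    obtain i j where ij: "v = theta_vertex k i j" "i < t" "j \<le> k"
      using v by (auto simp: theta_graph_def)
    \<comment> \<open>The last vertex of a path lies on the edge before it, every other vertex on
      the edge after it.\<close>
    define j' where "j' = (if j = k then k - 1 else j)"
    have "j' < k" using ij k by (auto simp: j'_def)
    then have "{theta_vertex k i j', theta_vertex k i (Suc j')} \<in> edges ?F"
      using ij by (simp add: theta_graph_def) blast
    moreover have "v \<in> {theta_vertex k i j', theta_vertex k i (Suc j')}"
      using ij k by (auto simp: j'_def)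
    ultimately obtain e where e: "e \<in> edges ?F" "v \<in> e" by blast
    then have "f v \<in> \<phi> e" "\<phi> e \<in> edges H" using \<phi>(2)[of e] by auto
    then show ?thesis using H unfolding uniform_hypergraph_def by blast
  qed
  then have "f ` verts ?F \<subseteq> verts ?G" by auto
  moreover have "bij_betw \<phi> (edges ?F) (edges ?G)" using \<phi>(1) by (simp add: inj_on_imp_bij_betw)
  ultimately have "is_berge ?F ?G"
    using f \<phi>(2) unfolding is_berge_def by blast
  moreover have "uniform_hypergraph r ?G"
    using H \<phi>(2) unfolding uniform_hypergraph_def by simp
  ultimately show "?G \<in> berge_family r ?F"
    by (simp add: berge_family_def)
  show "contains_copy H ?G"
    using \<phi>(2) unfolding contains_copy_def by (auto intro!: exI[of _ id])
qed

lemma has_theta_edge: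
  assumes "\<forall>i<t. \<forall>j<k. (f (theta_vertex k i j), f (theta_vertex k i (Suc j))) \<in> E"
    and "e \<in> edges (theta_graph k t)"
  shows "\<exists>u v. (u, v) \<in> E \<and> f ` e = {u, v}"
  using assms by (auto simp: theta_graph_def)

lemma inj_on_image_theta_edges:
  assumes "inj_on f (verts (theta_graph k t))"
  shows "inj_on ((`) f) (edges (theta_graph k t))"
proof -
  have "edges (theta_graph k t) \<subseteq> Pow (verts (theta_graph k t))"
    using uniform_theta_graph unfolding uniform_hypergraph_def by blast
  then show ?thesis
    using inj_on_image_Pow[OF assms] inj_on_subset by blast
qed

lemma edges_theta_graph_bound:
  "finite (edges (theta_graph k t))" "card (edges (theta_graph k t)) \<le> t * k"
proof -
  have *: "edges (theta_graph k t) =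
      (\<lambda>(i, j). {theta_vertex k i j, theta_vertex k i (Suc j)}) ` ({..<t} \<times> {..<k})"
    by (auto simp: theta_graph_def)
  show "finite (edges (theta_graph k t))" unfolding * by simp
  show "card (edges (theta_graph k t)) \<le> t * k"
    unfolding * using card_image_le[of "{..<t} \<times> {..<k}"] by fastforce
qed

text \<open>Representatives are chosen greedily: whenever one is chosen, fewer than
  \<open>card I\<close> values are taken.\<close>

lemma distinct_representatives:
  assumes "finite I" and "\<And>i. i \<in> I \<Longrightarrow> finite (S i) \<and> card I \<le> card (S i)"
  shows "\<exists>\<phi>. inj_on \<phi> I \<and> (\<forall>i\<in>I. \<phi> i \<in> S i)"
  using assms
proof (induction I)
  case empty
  then show ?case by simp
next
  case (insert i I)
  have "\<exists>\<phi>. inj_on \<phi> I \<and> (\<forall>i\<in>I. \<phi> i \<in> S i)"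
  proof (rule insert.IH)
    fix j assume "j \<in> I"
    then show "finite (S j) \<and> card I \<le> card (S j)"
      using insert.prems[of j] insert.hyps by simp
  qed
  then obtain \<phi> where \<phi>: "inj_on \<phi> I" "\<forall>i\<in>I. \<phi> i \<in> S i" by blast
  have "card (\<phi> ` I) < card (S i)"
    using card_image_le[OF insert.hyps(1), of \<phi>] insert.prems[of i] insert.hyps by simp
  then have "\<not> S i \<subseteq> \<phi> ` I" using card_mono insert.hyps(1) by (metis finite_imageI not_le)
  then obtain y where y: "y \<in> S i" "y \<notin> \<phi> ` I" by blast
  have "inj_on (\<phi>(i := y)) I" using inj_on_fun_updI[OF \<phi>(1) y(2)] .
  moreover have "(\<phi>(i := y)) ` I = \<phi> ` I" using insert.hyps(2) by auto
  ultimately have "inj_on (\<phi>(i := y)) (insert i I)"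
    using y(2) insert.hyps(2) by simp
  moreover have "\<forall>j\<in>insert i I. (\<phi>(i := y)) j \<in> S j" using \<phi>(2) y(1) by simp
  ultimately show ?case by blast
qed

text \<open>
  If every covered pair had large codegree, then the shadow would have large minimum degree inside
  the neighbourhood of a vertex \<open>u\<close>. A spider with legs of length \<open>k - 1\<close> in this neighbourhood,
  with all leaves joined to \<open>u\<close>, is a theta graph, and its edges extend greedily to distinct
  hyperedges.
\<close>

lemma light_pair:
  fixes H :: "nat hypergraph"
  assumes H: "uniform_hypergraph r H" and r: "r \<ge> 2" and k: "k \<ge> 1" and t: "t \<ge> 1"
    and free: "\<And>G. G \<in> berge_family r (theta_graph k t) \<Longrightarrow> \<not> contains_copy H G"
    and D: "D \<subseteq> edges H" "D \<noteq> {}"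
  shows "\<exists>u v. u \<noteq> v \<and> (\<exists>e\<in>D. {u, v} \<subseteq> e) \<and>
    card {e \<in> D. {u, v} \<subseteq> e} < 2 ^ (2 * (t * k + 1) + 1)"
proof (rule ccontr)
  define K where "K = t * k + 1"
  define E where "E = {(u, v). u \<noteq> v \<and> (\<exists>e\<in>D. {u, v} \<subseteq> e)}"
  assume "\<not> ?thesis"
  then have heavy: "2 ^ (2 * K + 1) \<le> card {e \<in> D. {u, v} \<subseteq> e}" if "(u, v) \<in> E" for u v
    using that by (auto simp: E_def K_def not_less)
  have finH: "finite (verts H)" and eH: "\<And>e. e \<in> D \<Longrightarrow> e \<subseteq> verts H \<and> card e = r"
    using H D by (auto simp: uniform_hypergraph_def)
  have finD: "finite D" by (rule finite_subset[of _ "Pow (verts H)"]) (use finH eH in auto)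
  have EV: "E \<subseteq> verts H \<times> verts H" using eH by (auto simp: E_def)
  have "sym E" by (auto simp: E_def sym_def)
  obtain e0 where e0: "e0 \<in> D" using D by blast
  then have "2 \<le> card e0" using eH r by simp
  then obtain u v0 where uv: "u \<in> e0" "v0 \<in> e0" "u \<noteq> v0"
    by (metis card_2_iff' card_le_Suc0_iff_eq card.infinite not_less_eq_eq numeral_2_eq_2 zero_le rel_simps(45))
  then have uvE: "(u, v0) \<in> E" using e0 by (auto simp: E_def)
  define S where "S = E `` {u}"
  have S: "v0 \<in> S" "u \<notin> S" using uvE by (auto simp: S_def E_def)
  \<comment> \<open>A hyperedge through \<open>u\<close> and \<open>v\<close> is determined by its
    remaining vertices, which are common neighbours of \<open>u\<close> and \<open>v\<close>. Hence
    \<open>2 ^ (2 * K + 1)\<close> such hyperedges force at least \<open>2 * K + 1\<close> common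
    neighbours.\<close>
  have common: "2 * K < card (E `` {v} \<inter> S)" if "v \<in> S" for v
  proof -
    let ?N = "E `` {v} \<inter> S"
    let ?D = "{e \<in> D. {u, v} \<subseteq> e}"
    have fin: "finite ?N" by (rule finite_subset[of _ "verts H"]) (use EV finH in auto)
    have "inj_on (\<lambda>e. e - {u, v}) ?D" by (auto simp: inj_on_def)
    moreover have "(\<lambda>e. e - {u, v}) ` ?D \<subseteq> Pow ?N" by (auto simp: S_def E_def)
    ultimately have "card ?D \<le> card (Pow ?N)"
      by (rule card_inj_on_le) (use fin in blast)
    moreover have "2 ^ (2 * K + 1) \<le> card ?D" by (rule heavy) (use that S_def in blast)
    ultimately have "2 ^ (2 * K + 1) \<le> (2::nat) ^ card ?N"
      using card_Pow[OF fin] by linarith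
    then have "2 * K + 1 \<le> card ?N" by (rule power_le_imp_le_exp[rotated]) simp
    then show ?thesis by simp
  qed
  have step: "\<exists>b\<in>S. (a, b) \<in> E \<and> b \<notin> X \<and> b \<notin> Y"
    if "a \<in> S" "finite X" "card X \<le> K" "finite Y" "card Y \<le> K" for a X Y
  proof -
    have "card (X \<union> Y) \<le> card X + card Y" by (rule card_Un_le)
    then have "card (X \<union> Y) < card (E `` {a} \<inter> S)" using common[OF that(1)] that by simp
    then have "\<not> E `` {a} \<inter> S \<subseteq> X \<union> Y" using that card_mono[of "X \<union> Y"] by (meson finite_UnI not_le)
    then show ?thesis by auto
  qed
  have "has_theta E k t"
  proof (cases "k = 1")
    case True
    then show ?thesis using has_theta_one[OF uvE uv(3)] by simp
  next
    case False
    \<comment> \<open>Here \<open>k - 1 \<ge> 1\<close>, as legs must have positive length. With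
      height 1 the colour of a leaf is the leaf itself, so avoiding \<open>X\<close> and
      \<open>Y\<close> means avoiding at most \<open>2 * K\<close> vertices.\<close>
    have "has_theta E ((k - 1) + 1) t"
    proof (rule spider_theta[where A = S and B = S and up = "\<lambda>_. u" and z = u and K = K])
      show "\<exists>b\<in>S. (a, b) \<in> E \<and> b \<notin> X" if "a \<in> S" "finite X" "card X \<le> K" for a X
        using step[of a X "{}"] that by simp
      show "\<exists>a\<in>S. (b, a) \<in> E \<and> a \<notin> X \<and> ((\<lambda>_. u) ^^ (1 - 1)) a \<notin> Y"
        if "b \<in> S" "finite X" "card X \<le> K" "finite Y" "card Y \<le> K" for b X Y
        using step[OF that] by simp
      show "S \<noteq> {}" using S by blast
      show "1 \<le> k - 1" using k False by simp
      show "t * (k - 1) + 1 \<le> K" by (simp add: K_def)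
      show "(((\<lambda>_. u) ^^ j) a, ((\<lambda>_. u) ^^ Suc j) a) \<in> E" if "a \<in> S" "j < 1" for a j
        using that \<open>sym E\<close> by (auto simp: S_def dest: symD)
      show "((\<lambda>_. u) ^^ j) a \<notin> S \<union> S" if "1 \<le> j" "j \<le> 1" for a :: nat and j
      proof -
        have "j = 1" using that by simp
        then show ?thesis using S by simp
      qed
      show "j = j'"
        if "a \<in> S" "a' \<in> S" "j \<le> 1" "j' \<le> 1" "((\<lambda>_. u) ^^ j) a = ((\<lambda>_. u) ^^ j') a'" for a a' j j'
      proof -
        have "j = 0 \<or> j = 1" "j' = 0 \<or> j' = 1" using that by auto
        then show ?thesis using that S by auto
      qed
    qed (use t in auto)
    then show ?thesis using k by simp
  qed
  then obtain f where f: "inj_on f (verts (theta_graph k t))"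
    "\<forall>i<t. \<forall>j<k. (f (theta_vertex k i j), f (theta_vertex k i (Suc j))) \<in> E"
    unfolding has_theta_def by blast
  let ?S = "\<lambda>e. {d \<in> D. f ` e \<subseteq> d}"
  have "\<exists>\<phi>. inj_on \<phi> (edges (theta_graph k t)) \<and> (\<forall>e\<in>edges (theta_graph k t). \<phi> e \<in> ?S e)"
  proof (rule distinct_representatives[OF edges_theta_graph_bound(1)])
    fix e assume "e \<in> edges (theta_graph k t)"
    then obtain u v where uv: "(u, v) \<in> E" "f ` e = {u, v}"
      using has_theta_edge[OF f(2)] by blast
    \<comment> \<open>The same codegree bound exceeds the number of theta edges, so distinct
      hyperedges can be chosen for them.\<close>
    have "t * k \<le> 2 * K + 1" by (simp add: K_def)
    also have "\<dots> \<le> 2 ^ (2 * K + 1)" by (simp add: less_imp_le del: power_Suc power_add)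
    also have "\<dots> \<le> card (?S e)" using heavy[OF uv(1)] uv(2) by simp
    finally show "finite (?S e) \<and> card (edges (theta_graph k t)) \<le> card (?S e)"
      using finD edges_theta_graph_bound(2)[of k t] by simp
  qed
  then obtain \<phi> where \<phi>: "inj_on \<phi> (edges (theta_graph k t))"
    "\<And>e. e \<in> edges (theta_graph k t) \<Longrightarrow> \<phi> e \<in> edges H \<and> f ` e \<subseteq> \<phi> e"
    using D(1) by blast
  show False
    using contains_berge_theta[OF H k f(1) \<phi>] free by blast
qed

text \<open>No hyperedge left after a round covers the picked pair \<open>{u, v}\<close>. So neither
  this pair nor its label \<open>e\<close> can occur again, which makes the labelling injective.
  Each round deletes fewer than \<open>M\<close> hyperedges for one new pair.\<close>

lemma labelled_graph:
  assumes "finite D"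
    and light: "\<And>D'. D' \<subseteq> D \<Longrightarrow> D' \<noteq> {} \<Longrightarrow>
      \<exists>u v. u \<noteq> v \<and> (\<exists>e\<in>D'. {u, v} \<subseteq> e) \<and> card {e \<in> D'. {u, v} \<subseteq> e} < M"
  shows "\<exists>P \<psi>. inj_on \<psi> P \<and> (\<forall>p\<in>P. \<psi> p \<in> D \<and> p \<subseteq> \<psi> p \<and> card p = 2) \<and> card D \<le> M * card P"
  using assms
proof (induction D rule: finite_psubset_induct)
  case (psubset D)
  show ?case
  proof (cases "D = {}")
    case True
    then show ?thesis by (intro exI[of _ "{}"]) auto
  next
    case False
    then obtain u v e where uv: "u \<noteq> v" "e \<in> D" "{u, v} \<subseteq> e" "card {e \<in> D. {u, v} \<subseteq> e} < M"
      using psubset.prems[of D] by blast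
    define D' where "D' = D - {e \<in> D. {u, v} \<subseteq> e}"
    have D': "D' \<subset> D" using uv by (auto simp: D'_def)
    have "\<exists>P \<psi>. inj_on \<psi> P \<and> (\<forall>p\<in>P. \<psi> p \<in> D' \<and> p \<subseteq> \<psi> p \<and> card p = 2) \<and> card D' \<le> M * card P"
      by (rule psubset.IH[OF D'], rule psubset.prems) (use D' in auto)
    then obtain P \<psi> where P: "inj_on \<psi> P" and P_all: "\<forall>p\<in>P. \<psi> p \<in> D' \<and> p \<subseteq> \<psi> p \<and> card p = 2"
      and cardP: "card D' \<le> M * card P"
      by (elim exE conjE)
    note P2 = bspec[OF P_all]
    have new: "{u, v} \<notin> P" using P2[of "{u, v}"] by (auto simp: D'_def)
    have "finite (\<psi> ` P)"
      by (rule finite_subset[of _ D]) (use P2 D' psubset.hyps in auto)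
    then have "finite P" using P finite_imageD by blast
    let ?\<psi> = "\<psi>({u, v} := e)"
    have "e \<notin> \<psi> ` P" using P2 uv(3) by (auto simp: D'_def)
    then have "inj_on ?\<psi> P" using inj_on_fun_updI[OF P] by blast
    moreover have "?\<psi> ` P = \<psi> ` P" using new by (intro image_cong) auto
    ultimately have "inj_on ?\<psi> (insert {u, v} P)" using \<open>e \<notin> \<psi> ` P\<close> new by simp
    moreover have "\<forall>p\<in>insert {u, v} P. ?\<psi> p \<in> D \<and> p \<subseteq> ?\<psi> p \<and> card p = 2"
      using P2 D' uv by auto
    moreover have "card D \<le> M * card (insert {u, v} P)"
    proof -
      have "card D = card D' + card {e \<in> D. {u, v} \<subseteq> e}"
        unfolding D'_def using psubset.hyps(1)
        by (subst card_Diff_subset) (auto simp: card_mono)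
      then show ?thesis using cardP uv(4) new \<open>finite P\<close> by simp
    qed
    ultimately show ?thesis by blast
  qed
qed

theorem theorem2:
  fixes r k t :: nat
  assumes "r \<ge> 2" and "k \<ge> 1" and "t \<ge> 1"
  shows "\<exists>c::real. \<forall>n::nat. n \<ge> 1 \<longrightarrow>
           real (ex_number r n (berge_family r (theta_graph k t)))
             \<le> c * real n powr (1 + 1 / real k)"
proof -
  define M :: nat where "M = 2 ^ (2 * (t * k + 1) + 1)"
  obtain C :: real where C: "card E \<le> C * card V powr (1 + 1 / k)"
    if "finite V" "E \<subseteq> V \<times> V" "sym E" "\<not> has_theta E k t" for V and E :: "(nat \<times> nat) set"
    using theta_free_edges[OF assms(2,3), where 'a = nat] by blast
  have bound: "card (edges H) \<le> M * C * n powr (1 + 1 / k)"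
    if "H \<in> free_hypergraphs r n (berge_family r (theta_graph k t))" for H n
  proof -
    have H: "uniform_hypergraph r H" "card (verts H) = n"
      and free: "\<And>G. G \<in> berge_family r (theta_graph k t) \<Longrightarrow> \<not> contains_copy H G"
      using that by (auto simp: free_hypergraphs_def)
    have finH: "finite (verts H)" and eH: "\<And>e. e \<in> edges H \<Longrightarrow> e \<subseteq> verts H"
      using H by (auto simp: uniform_hypergraph_def)
    have "finite (edges H)" by (rule finite_subset[of _ "Pow (verts H)"]) (use finH eH in auto)
    then have "\<exists>P \<psi>. inj_on \<psi> P \<and> (\<forall>p\<in>P. \<psi> p \<in> edges H \<and> p \<subseteq> \<psi> p \<and> card p = 2) \<and>
        card (edges H) \<le> M * card P"
      by (rule labelled_graph) (unfold M_def, rule light_pair[OF H(1) assms free])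
    then obtain P \<psi> where P: "inj_on \<psi> P" and P_all: "\<forall>p\<in>P. \<psi> p \<in> edges H \<and> p \<subseteq> \<psi> p \<and> card p = 2"
      and cardP: "card (edges H) \<le> M * card P"
      by (elim exE conjE)
    note P2 = bspec[OF P_all]
    define E where "E = {(u, v). {u, v} \<in> P}"
    have EV: "E \<subseteq> verts H \<times> verts H" using P2 eH by (fastforce simp: E_def)
    have finE: "finite E" using EV finH finite_subset by blast
    have "sym E" by (auto simp: E_def sym_def insert_commute)
    have "P \<subseteq> (\<lambda>(u, v). {u, v}) ` E"
    proof
      fix p assume "p \<in> P"
      moreover obtain u v where "p = {u, v}" using P2[OF \<open>p \<in> P\<close>] by (auto simp: card_2_iff)
      ultimately show "p \<in> (\<lambda>(u, v). {u, v}) ` E" by (auto simp: E_def)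
    qed
    then have "card P \<le> card E" using finE surj_card_le by blast
    moreover have "\<not> has_theta E k t"
    proof
      assume "has_theta E k t"
      then obtain f where f: "inj_on f (verts (theta_graph k t))"
        "\<forall>i<t. \<forall>j<k. (f (theta_vertex k i j), f (theta_vertex k i (Suc j))) \<in> E"
        unfolding has_theta_def by blast
      have fP: "f ` e \<in> P" if "e \<in> edges (theta_graph k t)" for e
        using has_theta_edge[OF f(2) that] by (auto simp: E_def)
      \<comment> \<open>Distinct theta edges become distinct pairs, and these carry distinct labels;
        so the labels turn a theta graph among the pairs into a Berge copy in
        \<open>H\<close>.\<close>
      have "inj_on (\<psi> \<circ> (`) f) (edges (theta_graph k t))"
        by (rule comp_inj_on[OF inj_on_image_theta_edges[OF f(1)]])
          (rule inj_on_subset[OF P], use fP in blast)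
      moreover have "(\<psi> \<circ> (`) f) e \<in> edges H \<and> f ` e \<subseteq> (\<psi> \<circ> (`) f) e"
        if "e \<in> edges (theta_graph k t)" for e
        using P2[OF fP[OF that]] by simp
      ultimately have "\<exists>G\<in>berge_family r (theta_graph k t). contains_copy H G"
        by (rule contains_berge_theta[OF H(1) assms(2) f(1)])
      then show False using free by blast
    qed
    then have "card E \<le> C * n powr (1 + 1 / k)" using C[OF finH EV \<open>sym E\<close>] H(2) by simp
    ultimately have "real (card P) \<le> C * n powr (1 + 1 / k)" by linarith
    then have "real M * card P \<le> real M * (C * n powr (1 + 1 / k))"
      by (intro mult_left_mono) auto
    moreover have "real (card (edges H)) \<le> real M * card P"
      using cardP by (metis of_nat_le_iff of_nat_mult)
    ultimately show ?thesis by (simp add: mult.assoc)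
  qed
  have "real (ex_number r n (berge_family r (theta_graph k t))) \<le> M * C * n powr (1 + 1 / k)" for n
  proof -
    let ?A = "(\<lambda>H. card (edges H)) ` free_hypergraphs r n (berge_family r (theta_graph k t))"
    have "?A \<noteq> {}" using free_hypergraphs_theta_nonempty[OF assms(2,3)] by simp
    then have "Max ?A \<in> ?A" by (intro Max_in finite_card_edges_free)
    then show ?thesis using bound unfolding ex_number_def by auto
  qed
  then show ?thesis by blast
qed

end
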